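(* Consider any of the privacy definitions pDP, aDP, RpDP, RaDP, let $\Xi$ be a privacy parameter for it, and let $\alpha>0$. Suppose there exists a $\Xi$-privacy property tester with proximity parameter $\alpha$ and per-database query complexity $r$. Let $\mathcal{A}=\{P_D\}$ be an algorithm that is $\alpha$-far from $\Xi$-private. (1) If the privacy notion is pDP or aDP, then there exists a pair of neighbouring databases that are $r$-distinguishable under $\mathcal{A}$. (2) If the privacy notion is RpDP with $\Xi=(\epsilon,\gamma)$ or RaDP with $\Xi=(\epsilon,\delta,\gamma)$, then a randomly sampled pair of neighbouring databases $(D,[D_{-1},z])$ has probability at least $\gamma+\frac{\alpha}{\lambda}$ of being $r$-distinguishable under $\mathcal{A}$.
   Context: Databases and algorithms. A database is a vector $D\in\mathbb{Z}^{|\Omega|}$ over a data universe $\Omega$ ($D_\omega$ = number of copies of $\omega$). Two databases are neighbouring if they differ on a single data point. A randomised algorithm $\mathcal{A}$ is identified with the collection of distributions $\{P_D\}$ of its outputs $\mathcal{A}(D)\sim P_D$, one for each database $D$ it accepts; outputs lie in $[n]=\{1,\dots,n\}$. $P^r$ denotes $r$ independent copies of $P$. $\mathcal{A}=(P_0,P_1)$ denotes an algorithm accepting only two databases $0,1$, which are assumed neighbouring, with $\mathcal{A}(0)\sim P_0$, $\mathcal{A}(1)\sim P_1$; property testers may be applied to such two-database algorithms. Divergences. $D_\infty(P,Q)=\sup_E\ln\frac{P(E)}{Q(E)}$ and $D^\delta_\infty(P,Q)=\sup_{E:\,P(E)\ge\delta}\ln\frac{P(E)-\delta}{Q(E)}$,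 suprema over events $E$. Privacy. $\mathcal{A}$ is $\epsilon$-pDP if $\sup D_\infty(P_D,P_{D'})\le\epsilon$, and $(\epsilon,\delta)$-aDP if $\sup D_\infty^\delta(P_D,P_{D'})\le\epsilon$, suprema over ordered pairs of neighbouring databases. Let $\mathcal{D}$ be a distribution on $\Omega$; sample a database $D$ consisting of a fixed number of i.i.d. points from $\mathcal{D}$ and an independent $z\sim\mathcal{D}$, and let $[D_{-1},z]$ be $D$ with its first data point replaced by $z$ (this is a randomly sampled pair of neighbouring databases). $\mathcal{A}$ is $(\epsilon,\gamma)$-RpDP if $\mathbb{P}(D_\infty(P_D,P_{[D_{-1},z]})\le\epsilon)\ge1-\gamma$, and $(\epsilon,\delta,\gamma)$-RaDP if $\mathbb{P}(D^\delta_\infty(P_D,P_{[D_{-1},z]})\le\epsilon)\ge1-\gamma$. For a two-database algorithm $(P_0,P_1)$ the sampled pair of neighbours is the pair of databases $0,1$ with probability one. Distance to privacy. Fix a scalar $\lambda>0$. $\mathcal{A}$ is $\alpha$-far from $\Xi$-private if $\min_{\Xi'}\|\Xi'-\Xi\|>\alpha$, the minimum over all $\Xi'$ such that $\mathcal{A}$ is $\Xi'$-private, where: for pDP, $\|\Xi-\Xi'\|=|\epsilon-\epsilon'|$; for aDP, $\epsilon$ is kept fixed and $\|\Xi-\Xi'\|=|\delta-\delta'|$; for RpDP, $\|\Xi-\Xi'\|=\max\{|\epsilon-\epsilon'|,\lambda|\gamma-\gamma'|\}$; for RaDP, $\epsilon$ is kept fixed and $\|\Xi-\Xi'\|=\max\{|\delta-\delta'|,\lambda|\gamma-\gamma'|\}$.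 (The minimum is $+\infty$ if there is no such $\Xi'$.) Property tester. A $\Xi$-privacy property tester with proximity parameter $\alpha$, per-database query complexity $r$ and side information $S$ (possibly $S=\emptyset$; or $S=\{Q_D\}$, a purported untrusted description of all output distributions) has black-box access to $\mathcal{A}$, obtains $r$ independent samples from $P_D$ for each database $D$ it queries, and ACCEPTS with probability at least $2/3$ if $\mathcal{A}$ is $\Xi$-private and $S$ is accurate, and REJECTS with probability at least $2/3$ if $\mathcal{A}$ is $\alpha$-far from $\Xi$-private. Distinguishability. Databases $D,D'$ are $r$-distinguishable under $\mathcal{A}$ if there is a testing algorithm such that, given a description of $\mathcal{A}$ and $x\sim P_{D''}^r$ with $D''\in\{D,D'\}$, it accepts with probability at least $2/3$ if $D''=D$ and rejects with probability at least $2/3$ if $D''=D'$. *)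

theory Defs
  imports "HOL-Probability.Probability"
begin

section \<open>Databases and algorithms\<close>

text \<open>\<open>D \<omega>\<close> is the number of copies of \<open>\<omega>\<close>. Since the data universe is countable, every
  distribution on it is a \<open>pmf\<close>.\<close>

type_synonym 'w database = "'w \<Rightarrow> int"

text \<open>One data point is replaced by a different one; this is the relation of which
  \<open>(D, [D\<^sub>-\<^sub>1, z])\<close> is a random instance (unless \<open>z\<close> equals the replaced point).\<close>

definition neighbouring :: "'w database \<Rightarrow> 'w database \<Rightarrow> bool" where
  "neighbouring D D' \<longleftrightarrow> (\<exists>a b. a \<noteq> b \<and> D' = D(a := D a - 1, b := D b + 1))"

definition database_of :: "'w list \<Rightarrow> 'w database" where
  "database_of xs = (\<lambda>\<omega>. int (count (mset xs) \<omega>))"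

definition random_neighbours :: "nat \<Rightarrow> 'w pmf \<Rightarrow> ('w database \<times> 'w database) pmf" where
  "random_neighbours m \<D> =
     bind_pmf (replicate_pmf m \<D>) (\<lambda>xs.
     bind_pmf \<D> (\<lambda>z.
     return_pmf (database_of xs, database_of (z # tl xs))))"

text \<open>A setting records what a notion of privacy needs to know about the databases: which of
  them an algorithm accepts, which are neighbouring, and how a random pair of neighbours is
  drawn. The same definitions then apply to ordinary algorithms and to two-database ones.\<close>

record 'd setting =
  accepted :: "'d set"
  neighbours :: "'d \<Rightarrow> 'd \<Rightarrow> bool"
  random_pair :: "('d \<times> 'd) pmf"

definition data_setting :: "'w database set \<Rightarrow> nat \<Rightarrow> 'w pmf \<Rightarrow> 'w database setting" where
  "data_setting X m \<D> =
     \<lparr> accepted = X, neighbours = neighbouring, random_pair = random_neighbours m \<D> \<rparr>"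

text \<open>The databases 0 and 1 are \<open>False\<close> and \<open>True\<close>.\<close>

definition two_setting :: "bool setting" where
  "two_setting =
     \<lparr> accepted = UNIV, neighbours = (\<noteq>), random_pair = return_pmf (False, True) \<rparr>"

text \<open>Values of an algorithm outside \<^const>\<open>accepted\<close> are irrelevant.\<close>

type_synonym 'd algorithm = "'d \<Rightarrow> nat pmf"

definition algorithm_on :: "nat \<Rightarrow> 'd setting \<Rightarrow> 'd algorithm \<Rightarrow> bool" where
  "algorithm_on n F A \<longleftrightarrow> (\<forall>D\<in>accepted F. set_pmf (A D) \<subseteq> {1..n})"


section \<open>Divergences\<close>

text \<open>The logarithm on \<open>[0, \<infinity>]\<close>, with \<open>ln 0 = -\<infinity>\<close>. In the divergences, \<open>c / 0 = \<infinity>\<close> for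
  \<open>c > 0\<close>, and \<open>0 / 0 = 0\<close>, so that events with \<open>0 / 0\<close> do not contribute to the supremum.\<close>

definition ln_ennreal :: "ennreal \<Rightarrow> ereal" where
  "ln_ennreal x =
     (if x = 0 then -\<infinity> else if x = \<infinity> then \<infinity> else ereal (ln (enn2real x)))"

definition max_divergence :: "'a pmf \<Rightarrow> 'a pmf \<Rightarrow> ereal" where
  "max_divergence P Q =
     (SUP E. ln_ennreal (emeasure (measure_pmf P) E / emeasure (measure_pmf Q) E))"

definition approx_max_divergence :: "real \<Rightarrow> 'a pmf \<Rightarrow> 'a pmf \<Rightarrow> ereal" where
  "approx_max_divergence \<delta> P Q =
     (SUP E\<in>{E. \<delta> \<le> measure_pmf.prob P E}.
        ln_ennreal ((emeasure (measure_pmf P) E - ennreal \<delta>) / emeasure (measure_pmf Q) E))"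


section \<open>Privacy\<close>

datatype privacy =
    pDP real
  | aDP real real        \<comment> \<open>\<open>\<epsilon>\<close>, \<open>\<delta>\<close>\<close>
  | RpDP real real       \<comment> \<open>\<open>\<epsilon>\<close>, \<open>\<gamma>\<close>\<close>
  | RaDP real real real  \<comment> \<open>\<open>\<epsilon>\<close>, \<open>\<delta>\<close>, \<open>\<gamma>\<close>\<close>

fun privacy_parameter :: "privacy \<Rightarrow> bool" where
  "privacy_parameter (pDP \<epsilon>) \<longleftrightarrow> 0 \<le> \<epsilon>"
| "privacy_parameter (aDP \<epsilon> \<delta>) \<longleftrightarrow> 0 \<le> \<epsilon> \<and> \<delta> \<in> {0..1}"
| "privacy_parameter (RpDP \<epsilon> \<gamma>) \<longleftrightarrow> 0 \<le> \<epsilon> \<and> \<gamma> \<in> {0..1}"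
| "privacy_parameter (RaDP \<epsilon> \<delta> \<gamma>) \<longleftrightarrow> 0 \<le> \<epsilon> \<and> \<delta> \<in> {0..1} \<and> \<gamma> \<in> {0..1}"

definition neighbour_pairs :: "'d setting \<Rightarrow> ('d \<times> 'd) set" where
  "neighbour_pairs F = {(D, D'). D \<in> accepted F \<and> D' \<in> accepted F \<and> neighbours F D D'}"

fun is_private :: "'d setting \<Rightarrow> 'd algorithm \<Rightarrow> privacy \<Rightarrow> bool" where
  "is_private F A (pDP \<epsilon>) \<longleftrightarrow>
     (SUP (D, D')\<in>neighbour_pairs F. max_divergence (A D) (A D')) \<le> ereal \<epsilon>"
| "is_private F A (aDP \<epsilon> \<delta>) \<longleftrightarrow>
     (SUP (D, D')\<in>neighbour_pairs F. approx_max_divergence \<delta> (A D) (A D')) \<le> ereal \<epsilon>"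
| "is_private F A (RpDP \<epsilon> \<gamma>) \<longleftrightarrow>
     measure_pmf.prob (random_pair F) {(D, D'). max_divergence (A D) (A D') \<le> ereal \<epsilon>}
       \<ge> 1 - \<gamma>"
| "is_private F A (RaDP \<epsilon> \<delta> \<gamma>) \<longleftrightarrow>
     measure_pmf.prob (random_pair F)
       {(D, D'). approx_max_divergence \<delta> (A D) (A D') \<le> ereal \<epsilon>} \<ge> 1 - \<gamma>"

text \<open>Parameters that are not to be compared (different notions, or a different \<open>\<epsilon>\<close> where
  \<open>\<epsilon>\<close> is kept fixed) are at distance \<open>\<infinity>\<close>.\<close>

fun privacy_dist :: "real \<Rightarrow> privacy \<Rightarrow> privacy \<Rightarrow> ereal" where
  "privacy_dist l (pDP \<epsilon>) (pDP \<epsilon>') = ereal \<bar>\<epsilon> - \<epsilon>'\<bar>"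
| "privacy_dist l (aDP \<epsilon> \<delta>) (aDP \<epsilon>' \<delta>') =
     (if \<epsilon> = \<epsilon>' then ereal \<bar>\<delta> - \<delta>'\<bar> else \<infinity>)"
| "privacy_dist l (RpDP \<epsilon> \<gamma>) (RpDP \<epsilon>' \<gamma>') =
     ereal (max \<bar>\<epsilon> - \<epsilon>'\<bar> (l * \<bar>\<gamma> - \<gamma>'\<bar>))"
| "privacy_dist l (RaDP \<epsilon> \<delta> \<gamma>) (RaDP \<epsilon>' \<delta>' \<gamma>') =
     (if \<epsilon> = \<epsilon>' then ereal (max \<bar>\<delta> - \<delta>'\<bar> (l * \<bar>\<gamma> - \<gamma>'\<bar>)) else \<infinity>)"
| "privacy_dist l _ _ = \<infinity>"

text \<open>The infimum is \<open>\<infinity>\<close> over the empty set, and a minimum otherwise, since the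
  set of admissible parameters is closed.\<close>

definition far_from_private ::
    "real \<Rightarrow> real \<Rightarrow> 'd setting \<Rightarrow> 'd algorithm \<Rightarrow> privacy \<Rightarrow> bool" where
  "far_from_private l \<alpha> F A \<Xi> \<longleftrightarrow>
     (INF \<Xi>'\<in>{\<Xi>'. privacy_parameter \<Xi>' \<and> is_private F A \<Xi>'}. privacy_dist l \<Xi>' \<Xi>) > ereal \<alpha>"


section \<open>Property testers\<close>

text \<open>Randomised adaptive procedures with black-box access to an algorithm. A query to \<open>D\<close> is
  answered by a list of \<open>r\<close> independent samples from \<open>A D\<close>; \<open>Accept\<close> is \<open>Decide True\<close>.\<close>

datatype 'd strategy =
    Decide bool
  | Query 'd "nat list \<Rightarrow> 'd strategy"
  | Random "nat pmf" "nat \<Rightarrow> 'd strategy"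

primrec run :: "nat \<Rightarrow> 'd algorithm \<Rightarrow> 'd strategy \<Rightarrow> bool pmf" where
  "run r A (Decide b) = return_pmf b"
| "run r A (Query D k) = bind_pmf (replicate_pmf r (A D)) (\<lambda>xs. run r A (k xs))"
| "run r A (Random p k) = bind_pmf p (\<lambda>i. run r A (k i))"

text \<open>Only databases in \<open>Y\<close> are queried, and none of them twice, so that a run sees at most
  \<open>r\<close> samples of each database.\<close>

primrec queries_once :: "'d set \<Rightarrow> 'd strategy \<Rightarrow> bool" where
  "queries_once Y (Decide b) \<longleftrightarrow> True"
| "queries_once Y (Query D k) \<longleftrightarrow> D \<in> Y \<and> (\<forall>xs. queries_once (Y - {D}) (k xs))"
| "queries_once Y (Random p k) \<longleftrightarrow> (\<forall>i. queries_once Y (k i))"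

datatype side_kind = No_Side_Info | Output_Description

datatype 'd side_info = Nothing | Described "'d \<Rightarrow> nat pmf"

text \<open>A description is untrusted: it need not be that of the algorithm at hand.\<close>

fun possible_side_info :: "nat \<Rightarrow> 'd setting \<Rightarrow> side_kind \<Rightarrow> 'd side_info \<Rightarrow> bool" where
  "possible_side_info n F No_Side_Info S \<longleftrightarrow> S = Nothing"
| "possible_side_info n F Output_Description S \<longleftrightarrow> (\<exists>Q. S = Described Q \<and> algorithm_on n F Q)"

fun accurate :: "'d setting \<Rightarrow> 'd algorithm \<Rightarrow> 'd side_info \<Rightarrow> bool" where
  "accurate F A Nothing \<longleftrightarrow> True"
| "accurate F A (Described Q) \<longleftrightarrow> (\<forall>D\<in>accepted F. Q D = A D)"

definition tests_privacy_on ::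
    "'d setting \<Rightarrow> nat \<Rightarrow> side_kind \<Rightarrow> real \<Rightarrow> privacy \<Rightarrow> real \<Rightarrow> nat
      \<Rightarrow> ('d side_info \<Rightarrow> 'd strategy) \<Rightarrow> bool" where
  "tests_privacy_on F n K l \<Xi> \<alpha> r T \<longleftrightarrow>
     (\<forall>S. possible_side_info n F K S \<longrightarrow>
        queries_once (accepted F) (T S) \<and>
        (\<forall>A. algorithm_on n F A \<longrightarrow>
           (is_private F A \<Xi> \<and> accurate F A S \<longrightarrow> pmf (run r A (T S)) True \<ge> 2/3) \<and>
           (far_from_private l \<alpha> F A \<Xi> \<longrightarrow> pmf (run r A (T S)) False \<ge> 2/3)))"

text \<open>A property tester handles the algorithms in the given setting by \<open>T\<close> and the two-database
  algorithms by \<open>T\<^sub>2\<close>, with one and the same query complexity.\<close>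

definition privacy_tester ::
    "'d setting \<Rightarrow> nat \<Rightarrow> side_kind \<Rightarrow> real \<Rightarrow> privacy \<Rightarrow> real \<Rightarrow> nat
      \<Rightarrow> ('d side_info \<Rightarrow> 'd strategy) \<times> (bool side_info \<Rightarrow> bool strategy) \<Rightarrow> bool" where
  "privacy_tester F n K l \<Xi> \<alpha> r = (\<lambda>(T, T\<^sub>2).
     tests_privacy_on F n K l \<Xi> \<alpha> r T \<and> tests_privacy_on two_setting n K l \<Xi> \<alpha> r T\<^sub>2)"


section \<open>Distinguishability\<close>

text \<open>The randomised test \<open>\<phi>\<close> may depend on all of \<open>A\<close>, \<open>D\<close> and \<open>D'\<close>.\<close>

definition distinguishable :: "nat \<Rightarrow> 'd algorithm \<Rightarrow> 'd \<Rightarrow> 'd \<Rightarrow> bool" where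
  "distinguishable r A D D' \<longleftrightarrow>
     (\<exists>\<phi> :: nat list \<Rightarrow> bool pmf.
        pmf (bind_pmf (replicate_pmf r (A D)) \<phi>) True \<ge> 2/3 \<and>
        pmf (bind_pmf (replicate_pmf r (A D')) \<phi>) False \<ge> 2/3)"

end

theory Submission
  imports Defs
begin

text \<open>Some pair of databases already violates privacy by more than \<open>\<alpha>\<close>, so the two-database
  algorithm \<open>(P, Q)\<close> formed by their output distributions is \<open>\<alpha>\<close>-far from private, while
  \<open>(P, P)\<close> is private. The tester therefore tells the two apart, even if it is given the
  description \<open>(P, P)\<close> in both cases. As it sees at most \<open>r\<close> samples of the second database, it
  can be simulated from \<open>r\<close> samples of either \<open>P\<close> or \<open>Q\<close>: the queries to the first database are
  answered by fresh samples of \<open>P\<close>.\<close>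

section \<open>Divergences\<close>

lemma ln_ennreal_le_iff: "ln_ennreal x \<le> ereal e \<longleftrightarrow> x \<le> ennreal (exp e)"
proof (cases x)
  case (real y)
  have "ln y \<le> e \<longleftrightarrow> y \<le> exp e" if "0 < y"
    using that by (metis exp_le_cancel_iff exp_ln)
  with real show ?thesis
    by (cases "y = 0") (auto simp: ln_ennreal_def ennreal_le_iff)
next
  case top
  then show ?thesis by (simp add: ln_ennreal_def top_unique)
qed

text \<open>Clearing the denominator gives the familiar additive form of approximate privacy. It may
  range over all events, because one of mass below \<delta> under \<open>P\<close> satisfies the
  inequality trivially.\<close>

lemma approx_max_divergence_le_iff:
  assumes "0 \<le> \<delta>"
  shows "approx_max_divergence \<delta> P Q \<le> ereal \<epsilon> \<longleftrightarrow>
    (\<forall>E. measure_pmf.prob P E \<le> exp \<epsilon> * measure_pmf.prob Q E + \<delta>)"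
proof -
  have "ln_ennreal ((emeasure (measure_pmf P) E - ennreal \<delta>) / emeasure (measure_pmf Q) E) \<le> ereal \<epsilon>
      \<longleftrightarrow> measure_pmf.prob P E \<le> exp \<epsilon> * measure_pmf.prob Q E + \<delta>"
    if E: "\<delta> \<le> measure_pmf.prob P E" for E
  proof (cases "measure_pmf.prob Q E = 0")
    \<comment> \<open>The quotient is 0/0 = 0 if \<open>E\<close> has mass exactly \<delta> under
      \<open>P\<close>, and \<infinity> otherwise. In the first case the inequality is an equality,
      in the second it fails.\<close>
    case True
    then show ?thesis
      using E assms
      by (cases "measure_pmf.prob P E = \<delta>")
        (auto simp: ln_ennreal_le_iff measure_pmf.emeasure_eq_measure ennreal_minus
          ennreal_divide_zero top_unique)
  next
    case False
    then have "0 < measure_pmf.prob Q E"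
      by (simp add: zero_less_measure_iff)
    then show ?thesis
      using E assms
      by (simp add: ln_ennreal_le_iff measure_pmf.emeasure_eq_measure ennreal_minus
          divide_ennreal ennreal_le_iff pos_divide_le_eq algebra_simps)
  qed
  moreover have "measure_pmf.prob P E \<le> exp \<epsilon> * measure_pmf.prob Q E + \<delta>"
    if "\<not> \<delta> \<le> measure_pmf.prob P E" for E
    using that by (smt (verit) exp_gt_zero measure_nonneg mult_nonneg_nonneg)
  ultimately show ?thesis
    unfolding approx_max_divergence_def SUP_le_iff by blast
qed

lemma max_divergence_eq_approx: "max_divergence P Q = approx_max_divergence 0 P Q"
  by (simp add: max_divergence_def approx_max_divergence_def)

lemma approx_max_divergence_self_le:
  assumes "0 \<le> \<delta>" "0 \<le> \<epsilon>"
  shows "approx_max_divergence \<delta> P P \<le> ereal \<epsilon>"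
proof -
  have "measure_pmf.prob P E \<le> exp \<epsilon> * measure_pmf.prob P E + \<delta>" for E
    using assms mult_right_mono[of 1 "exp \<epsilon>" "measure_pmf.prob P E"] by simp
  then show ?thesis
    using assms by (simp add: approx_max_divergence_le_iff)
qed

lemma max_divergence_self_le: "0 \<le> \<epsilon> \<Longrightarrow> max_divergence P P \<le> ereal \<epsilon>"
  by (simp add: max_divergence_eq_approx approx_max_divergence_self_le)

text \<open>Every algorithm is private at \<delta> = 1. For an algorithm far from private this
  forces \<open>\<delta> + \<alpha>\<close> below 1, so that it is an admissible parameter.\<close>

lemma approx_max_divergence_le_1: "approx_max_divergence 1 P Q \<le> ereal \<epsilon>"
proof -
  have "measure_pmf.prob P E \<le> exp \<epsilon> * measure_pmf.prob Q E + 1" for E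
    using measure_pmf.prob_le_1[of P E] by (smt (verit) exp_gt_zero measure_nonneg mult_nonneg_nonneg)
  then show ?thesis
    by (simp add: approx_max_divergence_le_iff)
qed

text \<open>A violating event \<open>E\<close> supplies the witness P(E) - exp(\<epsilon>) Q(E): it
  exceeds \<delta>, and no \<delta>' that restores the bound can lie below it. One witness for all
  \<delta>' gives the uniform margin that a strict bound on an infimum needs.\<close>

lemma approx_max_divergence_gt_gap:
  assumes "0 \<le> \<delta>" "ereal \<epsilon> < approx_max_divergence \<delta> P Q"
  obtains \<delta>1 where "\<delta> < \<delta>1"
    "\<And>\<delta>'. 0 \<le> \<delta>' \<Longrightarrow> approx_max_divergence \<delta>' P Q \<le> ereal \<epsilon> \<Longrightarrow> \<delta>1 \<le> \<delta>'"
proof -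
  obtain E where E: "exp \<epsilon> * measure_pmf.prob Q E + \<delta> < measure_pmf.prob P E"
    using assms approx_max_divergence_le_iff[of \<delta> P Q \<epsilon>] by (metis not_le)
  show ?thesis
  proof (rule that)
    show "\<delta> < measure_pmf.prob P E - exp \<epsilon> * measure_pmf.prob Q E"
      using E by simp
    show "measure_pmf.prob P E - exp \<epsilon> * measure_pmf.prob Q E \<le> \<delta>'"
      if "0 \<le> \<delta>'" "approx_max_divergence \<delta>' P Q \<le> ereal \<epsilon>" for \<delta>'
      using that approx_max_divergence_le_iff[of \<delta>' P Q \<epsilon>] by (simp add: diff_le_eq add.commute)
  qed
qed

section \<open>Two-database algorithms\<close>

definition two_algorithm :: "nat pmf \<Rightarrow> nat pmf \<Rightarrow> bool algorithm" where
  "two_algorithm P Q = (\<lambda>b. if b then Q else P)"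

lemma neighbour_pairs_two_setting: "neighbour_pairs two_setting = {(False, True), (True, False)}"
  by (auto simp: neighbour_pairs_def two_setting_def)

lemma is_private_two_pDP:
  "is_private two_setting (two_algorithm P Q) (pDP \<epsilon>) \<longleftrightarrow>
     max_divergence P Q \<le> ereal \<epsilon> \<and> max_divergence Q P \<le> ereal \<epsilon>"
  by (simp add: neighbour_pairs_two_setting two_algorithm_def)

lemma is_private_two_aDP:
  "is_private two_setting (two_algorithm P Q) (aDP \<epsilon> \<delta>) \<longleftrightarrow>
     approx_max_divergence \<delta> P Q \<le> ereal \<epsilon> \<and> approx_max_divergence \<delta> Q P \<le> ereal \<epsilon>"
  by (simp add: neighbour_pairs_two_setting two_algorithm_def)

lemma is_private_two_RpDP:
  "is_private two_setting (two_algorithm P Q) (RpDP \<epsilon> \<gamma>) \<longleftrightarrow>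
     (if max_divergence P Q \<le> ereal \<epsilon> then 0 \<le> \<gamma> else 1 \<le> \<gamma>)"
  by (simp add: two_setting_def two_algorithm_def)

lemma is_private_two_RaDP:
  "is_private two_setting (two_algorithm P Q) (RaDP \<epsilon> \<delta> \<gamma>) \<longleftrightarrow>
     (if approx_max_divergence \<delta> P Q \<le> ereal \<epsilon> then 0 \<le> \<gamma> else 1 \<le> \<gamma>)"
  by (simp add: two_setting_def two_algorithm_def)

lemma is_private_two_same:
  "privacy_parameter \<Xi> \<Longrightarrow> is_private two_setting (two_algorithm P P) \<Xi>"
  by (cases \<Xi>)
    (simp_all add: is_private_two_pDP is_private_two_aDP is_private_two_RpDP is_private_two_RaDP
      max_divergence_self_le approx_max_divergence_self_le del: is_private.simps)

section \<open>Two-database algorithms that are far from private\<close>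

text \<open>An infimum of numbers above \<alpha> may still equal \<alpha>, hence the common lower
  bound \<beta> strictly above it.\<close>

lemma far_from_privateI:
  assumes "\<alpha> < \<beta>"
    and "\<And>\<Xi>'. privacy_parameter \<Xi>' \<Longrightarrow> is_private F A \<Xi>' \<Longrightarrow> ereal \<beta> \<le> privacy_dist l \<Xi>' \<Xi>"
  shows "far_from_private l \<alpha> F A \<Xi>"
proof -
  have "ereal \<beta> \<le> (INF \<Xi>'\<in>{\<Xi>'. privacy_parameter \<Xi>' \<and> is_private F A \<Xi>'}. privacy_dist l \<Xi>' \<Xi>)"
    using assms(2) by (intro INF_greatest) simp
  with assms(1) show ?thesis
    unfolding far_from_private_def by (metis less_le_trans ereal_less(5) less_ereal.simps(1))
qed

lemma far_from_privateD:
  assumes "far_from_private l \<alpha> F A \<Xi>" "privacy_parameter \<Xi>'" "is_private F A \<Xi>'"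
  shows "ereal \<alpha> < privacy_dist l \<Xi>' \<Xi>"
  using assms unfolding far_from_private_def by (auto dest: less_INF_D)

lemma far_two_pDP:
  assumes "ereal (\<epsilon> + \<alpha>) < max_divergence P Q"
  shows "far_from_private l \<alpha> two_setting (two_algorithm P Q) (pDP \<epsilon>)"
proof -
  \<comment> \<open>The divergence may be infinite, so a real \<mu> strictly below it is used; the
    margin is \<open>\<mu> - \<epsilon>\<close>.\<close>
  obtain \<mu> where \<mu>: "\<epsilon> + \<alpha> < \<mu>" "ereal \<mu> < max_divergence P Q"
    using ereal_dense2[OF assms] by auto
  show ?thesis
  proof (rule far_from_privateI)
    show "\<alpha> < \<mu> - \<epsilon>" using \<mu> by simp
    fix \<Xi>' assume "is_private two_setting (two_algorithm P Q) \<Xi>'"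
    then show "ereal (\<mu> - \<epsilon>) \<le> privacy_dist l \<Xi>' (pDP \<epsilon>)"
    proof (cases \<Xi>')
      case (pDP \<epsilon>')
      then have "max_divergence P Q \<le> ereal \<epsilon>'"
        using \<open>is_private _ _ _\<close> is_private_two_pDP by blast
      with \<mu>(2) have "\<mu> < \<epsilon>'" using less_le_trans by fastforce
      then show ?thesis using pDP by simp
    \<comment> \<open>Parameters of the other notions are at distance \<infinity>.\<close>
    qed auto
  qed
qed

lemma far_two_aDP:
  assumes "0 \<le> \<delta> + \<alpha>" "ereal \<epsilon> < approx_max_divergence (\<delta> + \<alpha>) P Q"
  shows "far_from_private l \<alpha> two_setting (two_algorithm P Q) (aDP \<epsilon> \<delta>)"
proof -
  obtain \<delta>1 where \<delta>1: "\<delta> + \<alpha> < \<delta>1"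
    "\<And>\<delta>'. 0 \<le> \<delta>' \<Longrightarrow> approx_max_divergence \<delta>' P Q \<le> ereal \<epsilon> \<Longrightarrow> \<delta>1 \<le> \<delta>'"
    using approx_max_divergence_gt_gap[OF assms] by blast
  show ?thesis
  proof (rule far_from_privateI)
    show "\<alpha> < \<delta>1 - \<delta>" using \<delta>1 by simp
    fix \<Xi>' assume *: "privacy_parameter \<Xi>'" "is_private two_setting (two_algorithm P Q) \<Xi>'"
    then show "ereal (\<delta>1 - \<delta>) \<le> privacy_dist l \<Xi>' (aDP \<epsilon> \<delta>)"
    proof (cases \<Xi>')
      case (aDP \<epsilon>' \<delta>')
      then have "approx_max_divergence \<delta>' P Q \<le> ereal \<epsilon>'" "0 \<le> \<delta>'"
        using * is_private_two_aDP by (blast, simp)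
      \<comment> \<open>If \<epsilon>' differs from \<epsilon>, the distance is \<infinity>.\<close>
      then have "\<epsilon>' = \<epsilon> \<Longrightarrow> \<delta>1 \<le> \<delta>'" using \<delta>1(2) by blast
      then show ?thesis using aDP by auto
    qed auto
  qed
qed

text \<open>The sampled pair is deterministic, so a violation has probability 0 or 1. Restoring
  privacy thus means raising \<epsilon> to the divergence or setting \<gamma>' = 1. The latter costs
  \<open>l * (1 - \<gamma>)\<close>, which exceeds \<alpha> by the second assumption.\<close>

lemma far_two_RpDP:
  assumes "0 < l" "\<gamma> + \<alpha> / l < 1" "ereal (\<epsilon> + \<alpha>) < max_divergence P Q"
  shows "far_from_private l \<alpha> two_setting (two_algorithm P Q) (RpDP \<epsilon> \<gamma>)"
proof -
  obtain \<mu> where \<mu>: "\<epsilon> + \<alpha> < \<mu>" "ereal \<mu> < max_divergence P Q"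
    using ereal_dense2[OF assms(3)] by auto
  show ?thesis
  proof (rule far_from_privateI)
    show "\<alpha> < min (\<mu> - \<epsilon>) (l * (1 - \<gamma>))"
      using \<mu> assms by (simp add: field_simps)
    fix \<Xi>' assume *: "privacy_parameter \<Xi>'" "is_private two_setting (two_algorithm P Q) \<Xi>'"
    then show "ereal (min (\<mu> - \<epsilon>) (l * (1 - \<gamma>))) \<le> privacy_dist l \<Xi>' (RpDP \<epsilon> \<gamma>)"
    proof (cases \<Xi>')
      case (RpDP \<epsilon>' \<gamma>')
      then have "max_divergence P Q \<le> ereal \<epsilon>' \<or> \<gamma>' = 1"
        using * is_private_two_RpDP[of P Q \<epsilon>' \<gamma>'] by (auto split: if_splits simp del: is_private.simps)
      then have "\<mu> - \<epsilon> \<le> \<bar>\<epsilon>' - \<epsilon>\<bar> \<or> l * (1 - \<gamma>) \<le> l * \<bar>\<gamma>' - \<gamma>\<bar>"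
      proof
        assume "max_divergence P Q \<le> ereal \<epsilon>'"
        with \<mu>(2) have "\<mu> < \<epsilon>'" using less_le_trans by fastforce
        then show ?thesis by linarith
      next
        assume "\<gamma>' = 1"
        then show ?thesis using assms(1) by (intro disjI2 mult_left_mono) auto
      qed
      then show ?thesis using RpDP by (auto simp del: ereal_max ereal_min)
    qed auto
  qed
qed

text \<open>The same dichotomy, with the gap in \<delta> in place of the one in \<epsilon>.\<close>

lemma far_two_RaDP:
  assumes "0 < l" "\<gamma> + \<alpha> / l < 1"
    and "0 \<le> \<delta> + \<alpha>" "ereal \<epsilon> < approx_max_divergence (\<delta> + \<alpha>) P Q"
  shows "far_from_private l \<alpha> two_setting (two_algorithm P Q) (RaDP \<epsilon> \<delta> \<gamma>)"
proof -
  obtain \<delta>1 where \<delta>1: "\<delta> + \<alpha> < \<delta>1"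
    "\<And>\<delta>'. 0 \<le> \<delta>' \<Longrightarrow> approx_max_divergence \<delta>' P Q \<le> ereal \<epsilon> \<Longrightarrow> \<delta>1 \<le> \<delta>'"
    using approx_max_divergence_gt_gap[OF assms(3,4)] by blast
  show ?thesis
  proof (rule far_from_privateI)
    show "\<alpha> < min (\<delta>1 - \<delta>) (l * (1 - \<gamma>))"
      using \<delta>1(1) assms by (simp add: field_simps)
    fix \<Xi>' assume *: "privacy_parameter \<Xi>'" "is_private two_setting (two_algorithm P Q) \<Xi>'"
    then show "ereal (min (\<delta>1 - \<delta>) (l * (1 - \<gamma>))) \<le> privacy_dist l \<Xi>' (RaDP \<epsilon> \<delta> \<gamma>)"
    proof (cases \<Xi>')
      case (RaDP \<epsilon>' \<delta>' \<gamma>')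
      then have "approx_max_divergence \<delta>' P Q \<le> ereal \<epsilon>' \<or> \<gamma>' = 1"
        using * is_private_two_RaDP[of P Q \<epsilon>' \<delta>' \<gamma>']
        by (auto split: if_splits simp del: is_private.simps)
      then have "\<delta>1 - \<delta> \<le> \<bar>\<delta>' - \<delta>\<bar> \<or> l * (1 - \<gamma>) \<le> l * \<bar>\<gamma>' - \<gamma>\<bar>" if "\<epsilon>' = \<epsilon>"
      proof
        assume "approx_max_divergence \<delta>' P Q \<le> ereal \<epsilon>'"
        with \<delta>1(2)[of \<delta>'] * RaDP that show ?thesis by auto
      next
        assume "\<gamma>' = 1"
        then show ?thesis using assms(1) by (intro disjI2 mult_left_mono) auto
      qed
      then show ?thesis using RaDP by (auto simp del: ereal_max ereal_min)
    qed auto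
  qed
qed

section \<open>Simulating a tester\<close>

text \<open>The list \<open>xs\<close> stands for the sample of the second database and is fixed in
  advance. Every query to that database would get the same answer, which is harmless since
  \<open>queries_once\<close> permits only one.\<close>

primrec simulate :: "nat \<Rightarrow> nat pmf \<Rightarrow> nat list \<Rightarrow> bool strategy \<Rightarrow> bool pmf" where
  "simulate r P xs (Decide b) = return_pmf b"
| "simulate r P xs (Query D k) =
     (if D then simulate r P xs (k xs)
      else bind_pmf (replicate_pmf r P) (\<lambda>ys. simulate r P xs (k ys)))"
| "simulate r P xs (Random p k) = bind_pmf p (\<lambda>i. simulate r P xs (k i))"

text \<open>Once the second database can no longer be queried, neither \<open>xs\<close> nor
  \<open>Q\<close> is consulted. This covers what follows the single query to it.\<close>

lemma simulate_eq_run: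
  assumes "queries_once Y s" "True \<notin> Y"
  shows "simulate r P xs s = run r (two_algorithm P Q) s"
  using assms
proof (induction s arbitrary: Y)
  case (Query D k)
  have "simulate r P xs (k ys) = run r (two_algorithm P Q) (k ys)" for ys
    by (rule Query.IH[of _ "Y - {D}"]) (use Query.prems in auto)
  moreover have "\<not> D" using Query.prems by (cases D) auto
  ultimately show ?case by (simp add: two_algorithm_def)
next
  case (Random p k)
  have "simulate r P xs (k i) = run r (two_algorithm P Q) (k i)" for i
    by (rule Random.IH[of _ Y]) (use Random.prems in auto)
  then show ?case by simp
qed simp

text \<open>The sample from \<open>Q\<close> is read at most once and is independent of all other
  draws, so it can be drawn before the run starts.\<close>

lemma run_eq_bind_simulate:
  assumes "queries_once Y s"
  shows "run r (two_algorithm P Q) s = bind_pmf (replicate_pmf r Q) (\<lambda>xs. simulate r P xs s)"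
  using assms
proof (induction s arbitrary: Y)
  case (Query D k)
  show ?case
  proof (cases D)
    case True
    have "simulate r P ys (k xs) = run r (two_algorithm P Q) (k xs)" for xs ys
      by (rule simulate_eq_run[of "Y - {D}"]) (use Query.prems True in auto)
    then show ?thesis using True by (simp add: two_algorithm_def)
  next
    case False
    have IH: "run r (two_algorithm P Q) (k ys)
        = bind_pmf (replicate_pmf r Q) (\<lambda>xs. simulate r P xs (k ys))" for ys
      by (rule Query.IH[of _ "Y - {D}"]) (use Query.prems in auto)
    show ?thesis
      \<comment> \<open>The fresh sample from \<open>P\<close> is exchanged with the sample from
        \<open>Q\<close> drawn at the outset.\<close>
      using False by (simp add: two_algorithm_def[of P Q] IH[unfolded two_algorithm_def]
          bind_commute_pmf[of "replicate_pmf r P"])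
  qed
next
  case (Random p k)
  have IH: "run r (two_algorithm P Q) (k i)
      = bind_pmf (replicate_pmf r Q) (\<lambda>xs. simulate r P xs (k i))" for i
    by (rule Random.IH[of _ Y]) (use Random.prems in auto)
  show ?case by (simp add: IH bind_commute_pmf[of p])
qed simp

lemma distinguishable_if_far:
  fixes A :: "'d algorithm"
  assumes T: "tests_privacy_on two_setting n K l \<Xi> \<alpha> r T" and "privacy_parameter \<Xi>"
    and n: "set_pmf (A D) \<subseteq> {1..n}" "set_pmf (A D') \<subseteq> {1..n}"
    and far: "far_from_private l \<alpha> two_setting (two_algorithm (A D) (A D')) \<Xi>"
  shows "distinguishable r A D D'"
proof -
  \<comment> \<open>This description is accurate for the private algorithm that outputs
    \<open>A D\<close> on both databases. For the far one it may be wrong, but rejection is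
    guaranteed under any side information.\<close>
  define S where "S = (case K of No_Side_Info \<Rightarrow> Nothing
    | Output_Description \<Rightarrow> Described (two_algorithm (A D) (A D)))"
  have alg: "algorithm_on n two_setting (two_algorithm (A D) (A D))"
    "algorithm_on n two_setting (two_algorithm (A D) (A D'))"
    using n by (auto simp: algorithm_on_def two_algorithm_def split: if_splits)
  have S: "possible_side_info n two_setting K S"
    "accurate two_setting (two_algorithm (A D) (A D)) S"
    using alg by (cases K; simp add: S_def)+
  have q: "queries_once (accepted two_setting) (T S)"
    and "pmf (run r (two_algorithm (A D) (A D)) (T S)) True \<ge> 2/3"
    and "pmf (run r (two_algorithm (A D) (A D')) (T S)) False \<ge> 2/3"
    using T S alg far is_private_two_same[OF \<open>privacy_parameter \<Xi>\<close>]
    unfolding tests_privacy_on_def by blast+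
  \<comment> \<open>The test is the simulation, with \<open>A D\<close> built into it; acceptance on
    \<open>A D\<close> and rejection on \<open>A D'\<close> are the two guarantees of the
    tester.\<close>
  then show ?thesis
    unfolding distinguishable_def run_eq_bind_simulate[OF q] by blast
qed

section \<open>Violating pairs of databases\<close>

text \<open>The parameter \<open>\<epsilon> + \<alpha>\<close> is at distance exactly \<alpha>, so
  privacy must fail there, and some pair exceeds the supremum bound.\<close>

lemma far_pDP_violation:
  assumes "0 < \<alpha>" "0 \<le> \<epsilon>" "far_from_private l \<alpha> F A (pDP \<epsilon>)"
  obtains D D' where "(D, D') \<in> neighbour_pairs F" "ereal (\<epsilon> + \<alpha>) < max_divergence (A D) (A D')"
proof -
  have "\<not> is_private F A (pDP (\<epsilon> + \<alpha>))"
    using far_from_privateD[OF assms(3), of "pDP (\<epsilon> + \<alpha>)"] assms(1,2)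
    by (auto simp del: is_private.simps)
  then show ?thesis
    using that by (auto simp: SUP_le_iff not_le)
qed

lemma far_aDP_violation:
  assumes "0 < \<alpha>" "privacy_parameter (aDP \<epsilon> \<delta>)" "far_from_private l \<alpha> F A (aDP \<epsilon> \<delta>)"
  obtains D D' where "(D, D') \<in> neighbour_pairs F"
    "ereal \<epsilon> < approx_max_divergence (\<delta> + \<alpha>) (A D) (A D')"
proof -
  \<comment> \<open>The distance from \<delta> to 1 must exceed \<alpha>, which makes
    \<open>\<delta> + \<alpha>\<close> admissible before privacy is refuted there.\<close>
  have "is_private F A (aDP \<epsilon> 1)"
    by (auto simp: SUP_le_iff approx_max_divergence_le_1)
  then have "\<delta> + \<alpha> < 1"
    using far_from_privateD[OF assms(3), of "aDP \<epsilon> 1"] assms(2) by (auto simp del: is_private.simps)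
  then have "\<not> is_private F A (aDP \<epsilon> (\<delta> + \<alpha>))"
    using far_from_privateD[OF assms(3), of "aDP \<epsilon> (\<delta> + \<alpha>)"] assms(1,2)
    by (auto simp del: is_private.simps)
  then show ?thesis
    using that by (auto simp: SUP_le_iff not_le)
qed

lemma prob_not_le_eq:
  "measure_pmf.prob p {(x, y). \<not> R x y} = 1 - measure_pmf.prob p {(x, y). R x y}"
proof -
  have "{(x, y). \<not> R x y} = UNIV - {(x, y). R x y}" by auto
  then show ?thesis using measure_pmf.prob_compl[of "{(x, y). R x y}" p] by simp
qed

text \<open>Raising \<epsilon> by \<alpha> costs exactly \<alpha>, so it is the change in \<gamma>
  that must make the distance exceed \<alpha>.\<close>

lemma far_RpDP_violation:
  assumes "0 < l" "0 < \<alpha>" "privacy_parameter (RpDP \<epsilon> \<gamma>)" "far_from_private l \<alpha> F A (RpDP \<epsilon> \<gamma>)"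
  shows "\<gamma> + \<alpha> / l
    < measure_pmf.prob (random_pair F) {(D, D'). \<not> max_divergence (A D) (A D') \<le> ereal (\<epsilon> + \<alpha>)}"
    (is "_ < ?p")
proof -
  \<comment> \<open>The maximum keeps the new parameter at or above \<gamma>. If it equalled
    \<gamma>, the distance would be only \<alpha>; hence it is the violation probability.\<close>
  have "is_private F A (RpDP (\<epsilon> + \<alpha>) (max \<gamma> ?p))"
    by (simp add: prob_not_le_eq)
  then have "\<alpha> < l * \<bar>max \<gamma> ?p - \<gamma>\<bar>"
    using far_from_privateD[OF assms(4), of "RpDP (\<epsilon> + \<alpha>) (max \<gamma> ?p)"] assms(2,3)
    by (auto simp: le_max_iff_disj simp del: is_private.simps ereal_max)
  with assms(1,2) show ?thesis
    by (auto simp: max_def field_simps split: if_splits)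
qed

lemma far_RaDP_violation:
  assumes "0 < l" "0 < \<alpha>" "privacy_parameter (RaDP \<epsilon> \<delta> \<gamma>)"
    "far_from_private l \<alpha> F A (RaDP \<epsilon> \<delta> \<gamma>)"
  shows "\<gamma> + \<alpha> / l < measure_pmf.prob (random_pair F)
    {(D, D'). \<not> approx_max_divergence (\<delta> + \<alpha>) (A D) (A D') \<le> ereal \<epsilon>}"
    (is "_ < ?p")
proof -
  have "is_private F A (RaDP \<epsilon> 1 \<gamma>)"
    using assms(3) by (simp add: approx_max_divergence_le_1)
  then have "\<delta> + \<alpha> < 1"
    using far_from_privateD[OF assms(4), of "RaDP \<epsilon> 1 \<gamma>"] assms(2,3)
    by (auto simp del: is_private.simps)
  moreover have "is_private F A (RaDP \<epsilon> (\<delta> + \<alpha>) (max \<gamma> ?p))"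
    by (simp add: prob_not_le_eq)
  ultimately have "\<alpha> < l * \<bar>max \<gamma> ?p - \<gamma>\<bar>"
    using far_from_privateD[OF assms(4), of "RaDP \<epsilon> (\<delta> + \<alpha>) (max \<gamma> ?p)"] assms(2,3)
    by (auto simp: le_max_iff_disj simp del: is_private.simps ereal_max)
  with assms(1,2) show ?thesis
    by (auto simp: max_def field_simps split: if_splits)
qed

text \<open>Distinguishability is derived only for accepted databases, and sampled pairs are known
  to be accepted only on the support.\<close>

lemma prob_mono_on_support:
  assumes "\<And>x. x \<in> set_pmf p \<Longrightarrow> x \<in> E \<Longrightarrow> x \<in> E'"
  shows "measure_pmf.prob p E \<le> measure_pmf.prob p E'"
proof -
  have "measure_pmf.prob p (E \<inter> set_pmf p) \<le> measure_pmf.prob p E'"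
    using assms by (intro measure_pmf.finite_measure_mono) auto
  then show ?thesis by (simp add: measure_Int_set_pmf)
qed

theorem theorem6:
  fixes X :: "('w :: countable) database set" and \<D> :: "'w pmf" and m n r :: nat
    and K :: side_kind and l \<alpha> :: real and \<Xi> :: privacy
    and A :: "'w database algorithm"
  defines "F \<equiv> data_setting X m \<D>"
  assumes "l > 0" and "\<alpha> > 0" and "m \<ge> 1"
    and "privacy_parameter \<Xi>"
    and "\<exists>T. privacy_tester F n K l \<Xi> \<alpha> r T"
    and "algorithm_on n F A"
    and "far_from_private l \<alpha> F A \<Xi>"
  shows "((\<exists>\<epsilon>. \<Xi> = pDP \<epsilon>) \<or> (\<exists>\<epsilon> \<delta>. \<Xi> = aDP \<epsilon> \<delta>) \<longrightarrow>
            (\<exists>D\<in>X. \<exists>D'\<in>X. neighbouring D D' \<and> distinguishable r A D D'))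
       \<and> (\<forall>\<gamma>. (\<exists>\<epsilon>. \<Xi> = RpDP \<epsilon> \<gamma>) \<or> (\<exists>\<epsilon> \<delta>. \<Xi> = RaDP \<epsilon> \<delta> \<gamma>) \<longrightarrow>
            set_pmf (random_neighbours m \<D>) \<subseteq> X \<times> X \<longrightarrow>
            measure_pmf.prob (random_neighbours m \<D>) {(D, D'). distinguishable r A D D'}
              \<ge> \<gamma> + \<alpha> / l)"
proof (intro conjI impI allI)
  obtain T where T: "tests_privacy_on two_setting n K l \<Xi> \<alpha> r T"
    using assms(6) unfolding privacy_tester_def by auto
  have dist: "distinguishable r A D D'"
    if "D \<in> X" "D' \<in> X" "far_from_private l \<alpha> two_setting (two_algorithm (A D) (A D')) \<Xi>" for D D'
    using that assms(7)
    by (intro distinguishable_if_far[OF T assms(5)]) (auto simp: algorithm_on_def F_def data_setting_def)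
  have pairs: "neighbour_pairs F = {(D, D'). D \<in> X \<and> D' \<in> X \<and> neighbouring D D'}"
    and random: "random_pair F = random_neighbours m \<D>"
    by (simp_all add: neighbour_pairs_def F_def data_setting_def)
  {
    assume "(\<exists>\<epsilon>. \<Xi> = pDP \<epsilon>) \<or> (\<exists>\<epsilon> \<delta>. \<Xi> = aDP \<epsilon> \<delta>)"
    then obtain D D' where "(D, D') \<in> neighbour_pairs F"
      "far_from_private l \<alpha> two_setting (two_algorithm (A D) (A D')) \<Xi>"
    proof (elim disjE exE)
      fix \<epsilon> assume \<Xi>: "\<Xi> = pDP \<epsilon>"
      then show ?thesis
        using far_pDP_violation[of \<alpha> \<epsilon> l F A] far_two_pDP assms(3,5,8) that by (metis privacy_parameter.simps(1))
    next
      fix \<epsilon> \<delta> assume \<Xi>: "\<Xi> = aDP \<epsilon> \<delta>"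
      then obtain D D' where "(D, D') \<in> neighbour_pairs F"
        "ereal \<epsilon> < approx_max_divergence (\<delta> + \<alpha>) (A D) (A D')"
        using far_aDP_violation assms(3,5,8) by metis
      then show ?thesis
        using \<Xi> assms(3,5) by (intro that) (auto intro!: far_two_aDP)
    qed
    then show "\<exists>D\<in>X. \<exists>D'\<in>X. neighbouring D D' \<and> distinguishable r A D D'"
      using dist pairs by auto
  }
  {
    fix \<gamma>
    assume "(\<exists>\<epsilon>. \<Xi> = RpDP \<epsilon> \<gamma>) \<or> (\<exists>\<epsilon> \<delta>. \<Xi> = RaDP \<epsilon> \<delta> \<gamma>)"
      and supp: "set_pmf (random_neighbours m \<D>) \<subseteq> X \<times> X"
    \<comment> \<open>\<open>E\<close> collects the pairs whose divergence stays too large after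
      \<epsilon> or \<delta> is raised by \<alpha>. The premise on \<gamma> in \<open>far\<close>
      makes \<gamma>' = 1 too costly; it follows below, as \<open>E\<close> has probability at most
      1.\<close>
    then obtain E where E: "\<gamma> + \<alpha> / l < measure_pmf.prob (random_neighbours m \<D>) E"
      and far: "\<And>D D'. \<gamma> + \<alpha> / l < 1 \<Longrightarrow> (D, D') \<in> E \<Longrightarrow>
        far_from_private l \<alpha> two_setting (two_algorithm (A D) (A D')) \<Xi>"
    proof (elim disjE exE)
      fix \<epsilon> assume \<Xi>: "\<Xi> = RpDP \<epsilon> \<gamma>"
      show ?thesis
      proof (rule that)
        show "\<gamma> + \<alpha> / l < measure_pmf.prob (random_neighbours m \<D>)
            {(D, D'). \<not> max_divergence (A D) (A D') \<le> ereal (\<epsilon> + \<alpha>)}"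
          using far_RpDP_violation assms(2,3,5,8) \<Xi> random by metis
      qed (use \<Xi> assms(2) in \<open>auto intro!: far_two_RpDP simp: not_le\<close>)
    next
      fix \<epsilon> \<delta> assume \<Xi>: "\<Xi> = RaDP \<epsilon> \<delta> \<gamma>"
      show ?thesis
      proof (rule that)
        show "\<gamma> + \<alpha> / l < measure_pmf.prob (random_neighbours m \<D>)
            {(D, D'). \<not> approx_max_divergence (\<delta> + \<alpha>) (A D) (A D') \<le> ereal \<epsilon>}"
          using far_RaDP_violation assms(2,3,5,8) \<Xi> random by metis
      qed (use \<Xi> assms(2,3,5) in \<open>auto intro!: far_two_RaDP simp: not_le\<close>)
    qed
    have "\<gamma> + \<alpha> / l < 1"
      using E measure_pmf.prob_le_1 by (rule less_le_trans)
    then have "measure_pmf.prob (random_neighbours m \<D>) E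
        \<le> measure_pmf.prob (random_neighbours m \<D>) {(D, D'). distinguishable r A D D'}"
      using supp by (intro prob_mono_on_support) (auto intro!: dist far)
    with E show "\<gamma> + \<alpha> / l
        \<le> measure_pmf.prob (random_neighbours m \<D>) {(D, D'). distinguishable r A D D'}"
      by simp
  }
qed

end
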